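(* Let $X$ be a $\mathbb{Z}^2$-subshift that is polygonal with respect to the convex integer polygon $\mathcal{P}$, and suppose $\mathcal{P}=n\mathcal{P}_0$ for some integer polygon $\mathcal{P}_0$ and some integer $n>1$. Then there is a recoding $Y$ of $X$ which is polygonal with respect to $\mathcal{P}_0$. Hence, for every positive integer $m$, $m\mathcal{P}_0=\frac{m}{n}\mathcal{P}$ is also a coding polygon for $Y$.
   Context: For a finite alphabet $\mathcal{A}$ (discrete topology), a $\mathbb{Z}^2$-subshift is a closed subset $X\subset\mathcal{A}^{\mathbb{Z}^2}$ (product topology) invariant under the shifts $(T^ux)(v)=x(u+v)$, $u\in\mathbb{Z}^2$. For $A,B\subset\mathbb{R}^2$, $A$ $X$-codes $B$ if whenever $x,x'\in X$ agree on $A\cap\mathbb{Z}^2$ they agree on $B\cap\mathbb{Z}^2$. A $\mathbb{Z}^2$-subshift $Y$ (possibly over another finite alphabet) is a recoding of $X$ if there are a finite set $F\subset\mathbb{Z}^2$ and a homeomorphism $\Psi:X\to Y$ commuting with the shift actions such that for all $(i,j)\in\mathbb{Z}^2$ and $x,x'\in X$: $\Psi(x)(i,j)=\Psi(x')(i,j)$ if and only if $x$ and $x'$ agree on $F+(i,j)$. An integer polygon is a polygon in $\mathbb{R}^2$ (including its interior) with all vertices in $\mathbb{Z}^2$; $n\mathcal{P}=\{nx: x\in\mathcal{P}\}$. A convex integer polygon $\mathcal{P}$ is a coding polygon for an infinite $\mathbb{Z}^2$-subshift $X$, and $X$ is polygonal with respect to $\mathcal{P}$, if for every vertex $v$ of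 $\mathcal{P}$, $\mathcal{P}\setminus\{v\}$ $X$-codes $\{v\}$. A polygonal shift is infinite by definition. *)

theory Defs
  imports "HOL-Analysis.Analysis"
begin

type_synonym 'a config = "int \<times> int \<Rightarrow> 'a"

definition lattice_point :: "int \<times> int \<Rightarrow> real \<times> real" where
  "lattice_point v = (real_of_int (fst v), real_of_int (snd v))"

definition shift :: "int \<times> int \<Rightarrow> 'a config \<Rightarrow> 'a config" where
  "shift u x = (\<lambda>v. x (u + v))"

definition full_shift :: "'a set \<Rightarrow> 'a config topology" where
  "full_shift A = product_topology (\<lambda>_. discrete_topology A) UNIV"

definition subshift :: "'a set \<Rightarrow> 'a config set \<Rightarrow> bool" where
  "subshift A X \<longleftrightarrow> finite A \<and> closedin (full_shift A) X \<and> (\<forall>u. shift u ` X = X)"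

definition agree_on :: "(int \<times> int) set \<Rightarrow> 'a config \<Rightarrow> 'a config \<Rightarrow> bool" where
  "agree_on S x x' \<longleftrightarrow> (\<forall>v\<in>S. x v = x' v)"

definition codes :: "'a config set \<Rightarrow> (real \<times> real) set \<Rightarrow> (real \<times> real) set \<Rightarrow> bool" where
  "codes X A B \<longleftrightarrow> (\<forall>x\<in>X. \<forall>x'\<in>X.
     agree_on (lattice_point -` A) x x' \<longrightarrow> agree_on (lattice_point -` B) x x')"

definition recoding :: "'a set \<Rightarrow> 'a config set \<Rightarrow> 'b set \<Rightarrow> 'b config set \<Rightarrow> bool" where
  "recoding A X B Y \<longleftrightarrow> subshift A X \<and> subshift B Y \<and>
     (\<exists>F \<Psi>. finite F \<and>
        homeomorphic_map (subtopology (full_shift A) X) (subtopology (full_shift B) Y) \<Psi> \<and>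
        (\<forall>u. \<forall>x\<in>X. \<Psi> (shift u x) = shift u (\<Psi> x)) \<and>
        (\<forall>w. \<forall>x\<in>X. \<forall>x'\<in>X. \<Psi> x w = \<Psi> x' w \<longleftrightarrow> agree_on ((\<lambda>f. f + w) ` F) x x'))"

(* A polygon includes its interior and is not degenerate (not empty, a point or a segment).
   The vertices of a convex polygon are its extreme points. *)
definition convex_integer_polygon :: "(real \<times> real) set \<Rightarrow> bool" where
  "convex_integer_polygon P \<longleftrightarrow> polytope P \<and> interior P \<noteq> {} \<and>
     {v. v extreme_point_of P} \<subseteq> range lattice_point"

definition dilate :: "real \<Rightarrow> (real \<times> real) set \<Rightarrow> (real \<times> real) set" where
  "dilate c P = (\<lambda>x. c *\<^sub>R x) ` P"

(* Also read as: X is polygonal with respect to P. *)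
definition coding_polygon :: "'a set \<Rightarrow> 'a config set \<Rightarrow> (real \<times> real) set \<Rightarrow> bool" where
  "coding_polygon A X P \<longleftrightarrow> subshift A X \<and> infinite X \<and> convex_integer_polygon P \<and>
     (\<forall>v. v extreme_point_of P \<longrightarrow> codes X (P - {v}) {v})"

end

theory Submission
  imports Defs
begin

text \<open>
  Let \<open>k\<close> be large and let one symbol of the recoding record the pattern of \<open>x\<close> seen through the
  window \<open>F\<close> of all lattice points of \<open>(k - 1) P0\<close>.  Knowing the recoded configuration at all
  lattice points of \<open>P0\<close> except a vertex \<open>v\<close> means, in particular, knowing \<open>x\<close> on the translates
  \<open>w + (k - 1) P0\<close> for the vertices \<open>w \<noteq> v\<close>.  What has to be recovered is \<open>x\<close> on
  \<open>v + (k - 1) P0\<close>, which lies in \<open>k P0\<close>.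

  Those translates cover \<open>k P0\<close> apart from a corner at \<open>k v\<close>, because a point of \<open>k P0\<close> is a
  combination of the vertices with nonnegative weights of sum \<open>k\<close>, and a weight of at least 1 on
  \<open>w\<close> puts it into \<open>w + (k - 1) P0\<close> (lemma \<open>dilate_convex_hull_cases\<close>).  On the uncovered points
  the weight of \<open>v\<close> is therefore within a bounded distance of \<open>k\<close>, hence at least \<open>n\<close> when \<open>k\<close> is
  large, and the copy of \<open>n P0\<close> whose vertex \<open>n v\<close> sits at such a point still fits into \<open>k P0\<close>.
  As \<open>n P0\<close> is a coding polygon for \<open>X\<close>, the symbol at the point is determined by the rest of
  that copy.  A linear functional exposing \<open>v\<close> is smaller on the rest of the copy, so the corner
  fills up by induction on the value of the functional
  (lemma \<open>agree_on_dilate_if_other_vertices\<close>).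

  Taking \<open>k\<close> large, rather than \<open>k = n\<close>, makes it unnecessary to write every lattice point of
  \<open>n P0\<close> as a sum of lattice points of \<open>P0\<close> and of \<open>(n - 1) P0\<close>: only translates by vertices,
  which are lattice points, occur.

  Passing from \<open>P0\<close> to \<open>m P0\<close> is easy, since \<open>m P0\<close> contains the translate
  \<open>(m - 1) v + P0\<close>, in which \<open>m v\<close> plays the part of \<open>v\<close> (lemma \<open>coding_polygon_dilate\<close>).
\<close>

section \<open>Dilates of convex sets and polygons\<close>

lemma dilate_add_mem:
  assumes "convex S" "0 \<le> a" "0 \<le> b" "p \<in> dilate a S" "q \<in> dilate b S"
  shows "p + q \<in> dilate (a + b) S"
proof -
  obtain x y where xy: "x \<in> S" "y \<in> S" "p = a *\<^sub>R x" "q = b *\<^sub>R y"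
    using assms(4,5) by (auto simp: dilate_def)
  show ?thesis
  proof (cases "a + b = 0")
    case True
    then have "a = 0" "b = 0" using assms(2,3) by auto
    then show ?thesis using xy by (auto simp: dilate_def)
  next
    case False
    let ?z = "(a / (a + b)) *\<^sub>R x + (b / (a + b)) *\<^sub>R y"
    have "?z \<in> S"
      using assms(1-3) xy False by (intro convexD) (auto simp flip: add_divide_distrib)
    moreover have "p + q = (a + b) *\<^sub>R ?z"
      using False xy by (simp add: scaleR_add_right)
    ultimately show ?thesis by (auto simp: dilate_def)
  qed
qed

lemma dilate_dilate: "dilate a (dilate b S) = dilate (a * b) S"
  by (auto simp: dilate_def image_image)

lemma nonneg_combination_mem_dilate:
  assumes "finite E" "E \<noteq> {}" "\<And>w. w \<in> E \<Longrightarrow> 0 \<le> l w"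
  shows "(\<Sum>w\<in>E. l w *\<^sub>R w) \<in> dilate (sum l E) (convex hull E)"
proof (cases "sum l E = 0")
  case True
  then have "\<And>w. w \<in> E \<Longrightarrow> l w = 0"
    using assms by (simp add: sum_nonneg_eq_0_iff)
  then show ?thesis using assms(2) hull_subset[of E convex] by (auto simp: dilate_def image_def)
next
  case False
  let ?z = "\<Sum>w\<in>E. (l w / sum l E) *\<^sub>R w"
  have "?z \<in> convex hull E"
    unfolding convex_hull_finite[OF assms(1)]
    using False assms(3)
    by (intro CollectI exI[of _ "\<lambda>w. l w / sum l E"])
      (simp add: sum_nonneg del: split_paired_All flip: sum_divide_distrib)
  moreover have "(\<Sum>w\<in>E. l w *\<^sub>R w) = sum l E *\<^sub>R ?z"
    using False by (simp add: scaleR_sum_right)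
  ultimately show ?thesis unfolding dilate_def by blast
qed

lemma combination_minus_vertex_mem_dilate:
  assumes "finite E" "w0 \<in> E" "\<And>w. w \<in> E \<Longrightarrow> 0 \<le> l w" "c \<le> l w0"
  shows "(\<Sum>w\<in>E. l w *\<^sub>R w) - c *\<^sub>R w0 \<in> dilate (sum l E - c) (convex hull E)"
proof -
  define l' where "l' = l(w0 := l w0 - c)"
  have "(\<Sum>w\<in>E. l' w *\<^sub>R w) = (\<Sum>w\<in>E. l w *\<^sub>R w) - c *\<^sub>R w0" "sum l' E = sum l E - c"
    using assms(1,2) by (simp_all add: l'_def sum.remove[of E w0] scaleR_diff_left)
  moreover have "(\<Sum>w\<in>E. l' w *\<^sub>R w) \<in> dilate (sum l' E) (convex hull E)"
    using assms by (intro nonneg_combination_mem_dilate) (auto simp: l'_def)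
  ultimately show ?thesis by simp
qed

text \<open>Write the point as a combination of \<open>E\<close> with nonnegative weights of sum \<open>m\<close>.  Subtracting
  a generator lowers its weight by 1, which is allowed if that weight is at least 1.  If no generator
  other than \<open>v\<close> has weight 1 or more, then these have total weight at most \<open>card E\<close>, which leaves
  at least \<open>c\<close> for \<open>v\<close>.\<close>

lemma dilate_convex_hull_cases:
  fixes v :: "real \<times> real" and m c :: real
  assumes "finite E" "v \<in> E" "real (card E) + c \<le> m" "0 \<le> m" "p \<in> dilate m (convex hull E)"
  obtains w where "w \<in> E" "w \<noteq> v" "p - w \<in> dilate (m - 1) (convex hull E)"
  | "p - c *\<^sub>R v \<in> dilate (m - c) (convex hull E)"
proof -
  obtain u where u: "\<And>w. w \<in> E \<Longrightarrow> 0 \<le> u w" "sum u E = 1" "p = m *\<^sub>R (\<Sum>w\<in>E. u w *\<^sub>R w)"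
    using assms(5) unfolding dilate_def convex_hull_finite[OF assms(1)] by blast
  define l where "l = (\<lambda>w. m * u w)"
  have l: "\<And>w. w \<in> E \<Longrightarrow> 0 \<le> l w" "sum l E = m" "p = (\<Sum>w\<in>E. l w *\<^sub>R w)"
    using u assms(4) by (simp_all add: l_def scaleR_sum_right flip: sum_distrib_left)
  show thesis
  proof (cases "\<exists>w\<in>E - {v}. 1 \<le> l w")
    case True
    then obtain w where w: "w \<in> E" "w \<noteq> v" "1 \<le> l w" by blast
    then have "p - w \<in> dilate (m - 1) (convex hull E)"
      using combination_minus_vertex_mem_dilate[OF assms(1), of w l 1] l by simp
    with w show ?thesis using that(1) by blast
  next
    case False
    have "sum l (E - {v}) \<le> (\<Sum>w\<in>E - {v}. 1)"
      using False by (intro sum_mono) force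
    also have "\<dots> \<le> real (card E)"
      using assms(1) by (auto intro: card_mono)
    finally have "c \<le> l v"
      using l(2) assms(1-3) by (simp add: sum.remove[of E v])
    then have "p - c *\<^sub>R v \<in> dilate (m - c) (convex hull E)"
      using combination_minus_vertex_mem_dilate[OF assms(1,2), of l c] l by simp
    then show ?thesis using that(2) by blast
  qed
qed

lemma extreme_point_of_dilate:
  assumes "c > 0"
  shows "v extreme_point_of dilate c S \<longleftrightarrow> (\<exists>w. w extreme_point_of S \<and> v = c *\<^sub>R w)"
proof -
  have inj: "inj ((*\<^sub>R) c :: real \<times> real \<Rightarrow> _)" using assms by (auto intro!: injI)
  have *: "c *\<^sub>R w extreme_point_of dilate c S \<longleftrightarrow> w extreme_point_of S" for w
    using face_of_linear_image[OF linear_scaleR inj, of "{w}" S]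
    by (simp add: face_of_singleton dilate_def)
  have "v = c *\<^sub>R (v /\<^sub>R c)" using assms by simp
  with * show ?thesis by metis
qed

lemma lattice_point_add: "lattice_point (u + v) = lattice_point u + lattice_point v"
  by (simp add: lattice_point_def)

lemma lattice_point_diff: "lattice_point (u - v) = lattice_point u - lattice_point v"
  by (simp add: lattice_point_def)

lemma lattice_point_eq_iff: "lattice_point u = lattice_point v \<longleftrightarrow> u = v"
  by (auto simp: lattice_point_def prod_eq_iff)

lemma scaleR_lattice_point:
  "real m *\<^sub>R lattice_point v = lattice_point (int m * fst v, int m * snd v)"
  by (simp add: lattice_point_def)

lemma convex_integer_polygon_dilate:
  assumes "convex_integer_polygon S" "m > 0"
  shows "convex_integer_polygon (dilate (real m) S)"
proof -
  have S: "polytope S" "interior S \<noteq> {}" "{v. v extreme_point_of S} \<subseteq> range lattice_point"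
    using assms by (auto simp: convex_integer_polygon_def)
  have inj: "inj ((*\<^sub>R) (real m) :: real \<times> real \<Rightarrow> _)" using assms by (auto intro!: injI)
  have "polytope (dilate (real m) S)"
    unfolding dilate_def by (intro polytope_linear_image S(1) linear_scaleR)
  moreover have "interior (dilate (real m) S) \<noteq> {}"
    unfolding dilate_def using S(2) by (simp add: interior_injective_linear_image[OF linear_scaleR inj])
  moreover have "{v. v extreme_point_of dilate (real m) S} \<subseteq> range lattice_point"
  proof
    fix v assume "v \<in> {v. v extreme_point_of dilate (real m) S}"
    then obtain w where "w extreme_point_of S" "v = real m *\<^sub>R w"
      using extreme_point_of_dilate[of "real m" v S] assms(2) by auto
    moreover from this S(3) obtain z where "w = lattice_point z" by blast
    ultimately show "v \<in> range lattice_point" using scaleR_lattice_point[of m z] by simp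
  qed
  ultimately show ?thesis by (simp add: convex_integer_polygon_def)
qed

lemma finite_lattice_points:
  assumes "bounded S"
  shows "finite (lattice_point -` S)"
proof -
  obtain b where b: "\<And>p. p \<in> S \<Longrightarrow> norm p \<le> b" using assms by (auto simp: bounded_iff)
  have "lattice_point -` S \<subseteq> {-\<lceil>b\<rceil>..\<lceil>b\<rceil>} \<times> {-\<lceil>b\<rceil>..\<lceil>b\<rceil>}"
  proof
    fix z assume "z \<in> lattice_point -` S"
    then have "norm (lattice_point z) \<le> b" using b by simp
    then have "\<bar>real_of_int (fst z)\<bar> \<le> b" "\<bar>real_of_int (snd z)\<bar> \<le> b"
      using order_trans[OF norm_fst_le] order_trans[OF norm_snd_le]
      unfolding lattice_point_def real_norm_def[symmetric] by blast+
    then have "\<bar>fst z\<bar> \<le> \<lceil>b\<rceil>" "\<bar>snd z\<bar> \<le> \<lceil>b\<rceil>" by linarith+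
    then show "z \<in> {-\<lceil>b\<rceil>..\<lceil>b\<rceil>} \<times> {-\<lceil>b\<rceil>..\<lceil>b\<rceil>}"
      by (auto simp: mem_Times_iff)
  qed
  then show ?thesis by (rule finite_subset) simp
qed

lemma polytope_extreme_point_exposed:
  fixes S :: "'a::euclidean_space set"
  assumes "polytope S" "v extreme_point_of S"
  obtains a where "\<And>w. w \<in> S \<Longrightarrow> w \<noteq> v \<Longrightarrow> a \<bullet> w < a \<bullet> v"
proof -
  have "{v} exposed_face_of S"
    using assms exposed_face_of_polyhedron polytope_imp_polyhedron face_of_singleton by blast
  then obtain a b where ab: "S \<subseteq> {x. a \<bullet> x \<le> b}" "{v} = S \<inter> {x. a \<bullet> x = b}"
    by (auto simp: exposed_face_of_def)
  have "a \<bullet> w < a \<bullet> v" if "w \<in> S" "w \<noteq> v" for w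
  proof -
    have "a \<bullet> w \<le> b" "a \<bullet> w \<noteq> b" "a \<bullet> v = b" using ab that by blast+
    then show ?thesis by simp
  qed
  then show thesis using that by blast
qed

lemma convex_hull_extreme_points:
  assumes "convex_integer_polygon S"
  shows "finite {v. v extreme_point_of S}" "{v. v extreme_point_of S} \<noteq> {}"
    "convex hull {v. v extreme_point_of S} = S"
proof -
  have S: "polytope S" "S \<noteq> {}" using assms by (auto simp: convex_integer_polygon_def)
  show "finite {v. v extreme_point_of S}"
    by (intro finite_polyhedron_extreme_points polytope_imp_polyhedron S)
  show *: "convex hull {v. v extreme_point_of S} = S"
    using Krein_Milman_Minkowski[of S] S(1) polytope_imp_compact polytope_imp_convex by metis
  show "{v. v extreme_point_of S} \<noteq> {}" using * S(2) by force
qed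

section \<open>Coding of a dilate by translates at the other vertices\<close>

lemma subshift_shift_mem: "subshift A X \<Longrightarrow> x \<in> X \<Longrightarrow> shift u x \<in> X"
  unfolding subshift_def by blast

text \<open>The heart of the matter: once the translates of \<open>(m - 1) P0\<close> at the other vertices are known,
  the corner of \<open>m P0\<close> at \<open>v\<close> can be filled in point by point.  The points are taken in the order
  of a linear functional that attains its maximum over \<open>P0\<close> only at \<open>v\<close>, so that the tip of the
  corner comes last.\<close>

lemma agree_on_dilate_if_other_vertices:
  fixes n :: nat and m :: real
  assumes X: "coding_polygon A X (dilate (real n) P0)"
    and P0: "convex_integer_polygon P0" and n: "n > 0"
    and v: "v extreme_point_of P0"
    and m: "real (card {w. w extreme_point_of P0}) + real n \<le> m"
    and x: "x \<in> X" "x' \<in> X"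
    and others: "\<And>w t. w extreme_point_of P0 \<Longrightarrow> w \<noteq> v \<Longrightarrow>
                   lattice_point t - w \<in> dilate (m - 1) P0 \<Longrightarrow> x t = x' t"
  shows "agree_on (lattice_point -` dilate m P0) x x'"
proof -
  have poly: "polytope P0" using P0 by (simp add: convex_integer_polygon_def)
  have sub: "subshift A X" using X by (simp add: coding_polygon_def)
  obtain a where a: "\<And>w. w \<in> P0 \<Longrightarrow> w \<noteq> v \<Longrightarrow> a \<bullet> w < a \<bullet> v"
    using polytope_extreme_point_exposed[OF poly v] by blast
  have fin: "finite (lattice_point -` dilate m P0)"
    unfolding dilate_def using poly by (intro finite_lattice_points bounded_scaling polytope_imp_bounded)
  have nv: "real n *\<^sub>R v extreme_point_of dilate (real n) P0"
    using v n extreme_point_of_dilate[of "real n" "real n *\<^sub>R v" P0] by (auto simp del: split_paired_Ex)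
  have codes: "codes X (dilate (real n) P0 - {real n *\<^sub>R v}) {real n *\<^sub>R v}"
    using X nv unfolding coding_polygon_def by blast
  obtain z where z: "real n *\<^sub>R v = lattice_point z"
    using X nv unfolding coding_polygon_def convex_integer_polygon_def by blast
  \<comment> \<open>There are finitely many lattice points, so counting those with a smaller value turns the
    order by a real functional into a well-founded one.\<close>
  let ?below = "\<lambda>t. {s \<in> lattice_point -` dilate m P0. a \<bullet> lattice_point s < a \<bullet> lattice_point t}"
  have "x t = x' t" if "lattice_point t \<in> dilate m P0" for t
    using that
  proof (induction "card (?below t)" arbitrary: t rule: less_induct)
    case less
    have mem: "lattice_point t \<in> dilate m (convex hull {w. w extreme_point_of P0})"
      using less.prems convex_hull_extreme_points(3)[OF P0] by simp
    have "0 \<le> m" using m by linarith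
    from _ _ m this mem show ?case
    proof (rule dilate_convex_hull_cases)
      show "finite {w. w extreme_point_of P0}" by (rule convex_hull_extreme_points[OF P0])
      show "v \<in> {w. w extreme_point_of P0}" using v by simp
    next
      fix w assume "w \<in> {w. w extreme_point_of P0}" "w \<noteq> v"
        "lattice_point t - w \<in> dilate (m - 1) (convex hull {w. w extreme_point_of P0})"
      then show ?thesis using others convex_hull_extreme_points(3)[OF P0] by simp
    next
      assume "lattice_point t - real n *\<^sub>R v \<in> dilate (m - real n) (convex hull {w. w extreme_point_of P0})"
      then have near: "lattice_point t - real n *\<^sub>R v \<in> dilate (m - real n) P0"
        using convex_hull_extreme_points(3)[OF P0] by simp
      \<comment> \<open>This translation carries the vertex \<open>n v\<close> of \<open>n P0\<close> to \<open>t\<close>.\<close>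
      let ?u = "t - z"
      have "agree_on (lattice_point -` (dilate (real n) P0 - {real n *\<^sub>R v})) (shift ?u x) (shift ?u x')"
        unfolding agree_on_def
      proof
        fix q assume "q \<in> lattice_point -` (dilate (real n) P0 - {real n *\<^sub>R v})"
        then have q: "lattice_point q \<in> dilate (real n) P0" "lattice_point q \<noteq> real n *\<^sub>R v" by auto
        let ?s = "?u + q"
        have s: "lattice_point ?s = (lattice_point t - real n *\<^sub>R v) + lattice_point q"
          by (simp add: lattice_point_add lattice_point_diff z)
        have s_mem: "lattice_point ?s \<in> dilate m P0"
          using dilate_add_mem[OF polytope_imp_convex[OF poly] _ _ near q(1)] m s by simp
        obtain y where y: "y \<in> P0" "lattice_point q = real n *\<^sub>R y"
          using q(1) by (auto simp: dilate_def)
        have "a \<bullet> y < a \<bullet> v" using a y q(2) by auto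
        then have lt: "a \<bullet> lattice_point ?s < a \<bullet> lattice_point t"
          unfolding s y(2) using n by (simp add: inner_simps)
        have "?below ?s \<subset> ?below t" using lt s_mem by auto
        then have "card (?below ?s) < card (?below t)"
          by (intro psubset_card_mono finite_subset[OF _ fin]) auto
        then have "x ?s = x' ?s" using less.hyps s_mem by blast
        then show "shift ?u x q = shift ?u x' q" by (simp add: shift_def)
      qed
      then have "agree_on (lattice_point -` {real n *\<^sub>R v}) (shift ?u x) (shift ?u x')"
        using codes x sub subshift_shift_mem unfolding codes_def by blast
      then show ?thesis by (simp add: agree_on_def z shift_def lattice_point_eq_iff)
    qed
  qed
  then show ?thesis by (simp add: agree_on_def)
qed

lemma codes_translate:
  assumes "subshift A X" "codes X S T"
  shows "codes X ((+) (lattice_point u) ` S) ((+) (lattice_point u) ` T)"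
  unfolding codes_def
proof (intro ballI impI)
  fix x x' assume x: "x \<in> X" "x' \<in> X"
    and ag: "agree_on (lattice_point -` (+) (lattice_point u) ` S) x x'"
  have "agree_on (lattice_point -` S) (shift u x) (shift u x')"
    using ag by (auto simp: agree_on_def shift_def lattice_point_add)
  then have agT: "agree_on (lattice_point -` T) (shift u x) (shift u x')"
    using assms x subshift_shift_mem unfolding codes_def by blast
  show "agree_on (lattice_point -` (+) (lattice_point u) ` T) x x'"
    unfolding agree_on_def
  proof
    fix t assume "t \<in> lattice_point -` (+) (lattice_point u) ` T"
    then have "t - u \<in> lattice_point -` T" by (auto simp: lattice_point_diff)
    then show "x t = x' t" using agT by (force simp: agree_on_def shift_def)
  qed
qed

lemma codes_mono: "codes X S T \<Longrightarrow> S \<subseteq> S' \<Longrightarrow> codes X S' T"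
  unfolding codes_def agree_on_def by blast

text \<open>Near its vertex \<open>m v\<close> the polygon \<open>m P0\<close> contains a lattice translate of \<open>P0\<close>, which
  already determines the symbol there.\<close>

lemma coding_polygon_dilate:
  assumes Y: "coding_polygon B Y P0" and m: "m > 0"
  shows "coding_polygon B Y (dilate (real m) P0)"
proof -
  have sub: "subshift B Y" and P0: "convex_integer_polygon P0"
    using Y by (auto simp: coding_polygon_def)
  have "codes Y (dilate (real m) P0 - {mv}) {mv}" if mv: "mv extreme_point_of dilate (real m) P0" for mv
  proof -
    obtain v where v: "v extreme_point_of P0" "mv = real m *\<^sub>R v"
      using mv m extreme_point_of_dilate[of "real m" mv P0] by auto
    obtain z where z: "v = lattice_point z"
      using v P0 unfolding convex_integer_polygon_def by blast
    define u where "u = (int (m - 1) * fst z, int (m - 1) * snd z)"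
    have u: "lattice_point u = (real m - 1) *\<^sub>R v"
      using scaleR_lattice_point[of "m - 1" z] m by (simp add: u_def z of_nat_diff)
    have mv_eq: "mv = lattice_point u + v" unfolding v u by (simp add: scaleR_diff_left)
    have "codes Y (P0 - {v}) {v}" using Y v unfolding coding_polygon_def by blast
    from codes_translate[OF sub this, of u]
    have "codes Y ((+) (lattice_point u) ` (P0 - {v})) {mv}" by (simp add: mv_eq)
    moreover have "(+) (lattice_point u) ` (P0 - {v}) \<subseteq> dilate (real m) P0 - {mv}"
    proof
      fix p assume "p \<in> (+) (lattice_point u) ` (P0 - {v})"
      then obtain y where y: "y \<in> P0" "y \<noteq> v" "p = lattice_point u + y" by auto
      have "v \<in> P0" using v by (simp add: extreme_point_of_def)
      then have "lattice_point u \<in> dilate (real m - 1) P0" by (auto simp: u dilate_def)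
      moreover have "y \<in> dilate 1 P0" using y by (simp add: dilate_def)
      moreover have "convex P0" using P0 by (simp add: convex_integer_polygon_def polytope_imp_convex)
      ultimately have "p \<in> dilate (real m - 1 + 1) P0"
        unfolding y(3) using m by (intro dilate_add_mem) auto
      then show "p \<in> dilate (real m) P0 - {mv}" using y by (simp add: mv_eq)
    qed
    ultimately show ?thesis by (rule codes_mono)
  qed
  then show ?thesis
    using Y convex_integer_polygon_dilate[OF P0 m] by (simp add: coding_polygon_def)
qed

section \<open>Recoding by finite windows\<close>

text \<open>The map \<open>c\<close> numbers the patterns on the window, so that the recoded alphabet consists of
  natural numbers.  Restricting makes two patterns equal as functions exactly when they agree on
  \<open>F\<close>, so \<open>c\<close> need only be injective on finitely many functions.\<close>

definition window_code :: "((int \<times> int \<Rightarrow> 'a) \<Rightarrow> nat) \<Rightarrow> (int \<times> int) set \<Rightarrow> 'a config \<Rightarrow> nat config"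
  where "window_code c F x = (\<lambda>w. c (restrict (\<lambda>f. x (f + w)) F))"

lemma topspace_full_shift: "topspace (full_shift A) = {x. range x \<subseteq> A}"
  by (auto simp: full_shift_def PiE_UNIV_domain)

lemma compact_space_subshift:
  assumes "subshift A X"
  shows "compact_space (subtopology (full_shift A) X)"
proof -
  have "compact_space (full_shift A)"
    using assms by (simp add: full_shift_def subshift_def compact_space_product_topology compact_space_discrete_topology)
  then have "compactin (full_shift A) X"
    using assms by (auto simp: subshift_def intro: closedin_compact_space)
  then show ?thesis by (rule compact_space_subtopology)
qed

lemma Hausdorff_full_shift: "Hausdorff_space (full_shift A)"
  by (simp add: full_shift_def Hausdorff_space_product_topology)

lemma openin_full_shift_coordinate: "openin (full_shift A) {x \<in> topspace (full_shift A). x v = b}"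
proof -
  have "continuous_map (full_shift A) (discrete_topology A) (\<lambda>x. x v)"
    unfolding full_shift_def by (rule continuous_map_product_projection) simp
  then have "openin (full_shift A) {x \<in> topspace (full_shift A). x v \<in> A \<inter> {b}}"
    by (rule openin_continuous_map_preimage) simp
  moreover have "{x \<in> topspace (full_shift A). x v \<in> A \<inter> {b}} = {x \<in> topspace (full_shift A). x v = b}"
    by (auto simp: topspace_full_shift)
  ultimately show ?thesis by simp
qed

text \<open>The set of configurations that share with \<open>x\<close> finitely many symbols is an open neighbourhood
  of \<open>x\<close>, and each output symbol is constant on such a neighbourhood.\<close>

lemma continuous_map_full_shift_if_local:
  assumes "\<And>x. x \<in> topspace (full_shift A) \<Longrightarrow> range (h x) \<subseteq> B"
    and "\<And>w. finite (W w)"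
    and "\<And>w x x'. agree_on (W w) x x' \<Longrightarrow> h x w = h x' w"
  shows "continuous_map (full_shift A) (full_shift B) h"
proof -
  have "continuous_map (full_shift A) (discrete_topology B) (\<lambda>x. h x w)" for w
    unfolding continuous_map
  proof (intro conjI allI impI)
    show "(\<lambda>x. h x w) ` topspace (full_shift A) \<subseteq> topspace (discrete_topology B)"
      using assms(1) by auto
    fix U
    show "openin (full_shift A) {x \<in> topspace (full_shift A). h x w \<in> U}"
    proof (subst openin_subopen, intro ballI)
      fix x assume x: "x \<in> {x \<in> topspace (full_shift A). h x w \<in> U}"
      let ?V = "topspace (full_shift A) \<inter> (\<Inter>v\<in>W w. {x' \<in> topspace (full_shift A). x' v = x v})"
      have "openin (full_shift A) ?V"
      proof (cases "W w = {}")
        case False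
        then show ?thesis
          by (intro openin_Int openin_INT2 assms(2) openin_full_shift_coordinate openin_topspace)
      qed simp
      moreover have "?V \<subseteq> {x \<in> topspace (full_shift A). h x w \<in> U}"
      proof
        fix x' assume x': "x' \<in> ?V"
        then have "agree_on (W w) x' x" by (auto simp: agree_on_def)
        with assms(3) x x' show "x' \<in> {x \<in> topspace (full_shift A). h x w \<in> U}" by fastforce
      qed
      ultimately show "\<exists>T. openin (full_shift A) T \<and> x \<in> T \<and> T \<subseteq> {x \<in> topspace (full_shift A). h x w \<in> U}"
        using x by (intro exI[of _ ?V]) auto
    qed
  qed
  then show ?thesis
    unfolding full_shift_def[of B] by (simp add: continuous_map_componentwise_UNIV)
qed

text \<open>Every nonempty finite window defines a recoding: a translate of the window covers any given
  site, so the code is injective, and a continuous bijection from the compact \<open>X\<close> onto a Hausdorff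
  space is a homeomorphism.  The same compactness makes the image closed.\<close>

lemma recoding_by_window:
  fixes X :: "'a config set"
  assumes X: "subshift A X" and F: "finite F" "F \<noteq> {}"
  obtains B :: "nat set" and Y \<Psi> where
    "recoding A X B Y" "Y = \<Psi> ` X" "inj_on \<Psi> X"
    "\<And>w x x'. x \<in> X \<Longrightarrow> x' \<in> X \<Longrightarrow> \<Psi> x w = \<Psi> x' w \<longleftrightarrow> agree_on ((\<lambda>f. f + w) ` F) x x'"
proof -
  have A: "finite A" and XA: "X \<subseteq> {x. range x \<subseteq> A}" and shiftX: "\<And>u. shift u ` X = X"
    using X closedin_subset[of "full_shift A" X] unfolding subshift_def topspace_full_shift by blast+
  have finP: "finite (F \<rightarrow>\<^sub>E A)" using A F by (simp add: finite_PiE)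
  obtain c :: "(int \<times> int \<Rightarrow> 'a) \<Rightarrow> nat" where c: "inj_on c (F \<rightarrow>\<^sub>E A)"
    using finite_imp_inj_to_nat_seg[OF finP] by blast
  define B where "B = c ` (F \<rightarrow>\<^sub>E A)"
  define \<Psi> where "\<Psi> = window_code c F"
  define Y where "Y = \<Psi> ` X"
  have pattern: "restrict (\<lambda>f. x (f + w)) F \<in> F \<rightarrow>\<^sub>E A" if "range x \<subseteq> A" for x w
    using that by auto
  have agree: "restrict (\<lambda>f. x (f + w)) F = restrict (\<lambda>f. x' (f + w)) F \<longleftrightarrow> agree_on ((\<lambda>f. f + w) ` F) x x'"
    for x x' :: "'a config" and w
    by (auto simp: agree_on_def restrict_def fun_eq_iff)
  have eq: "\<Psi> x w = \<Psi> x' w \<longleftrightarrow> agree_on ((\<lambda>f. f + w) ` F) x x'" if "x \<in> X" "x' \<in> X" for x x' w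
  proof -
    have "range x \<subseteq> A" "range x' \<subseteq> A" using that XA by auto
    then show ?thesis
      unfolding \<Psi>_def window_code_def agree[symmetric] by (intro inj_on_eq_iff[OF c] pattern)
  qed
  have inj: "inj_on \<Psi> X"
  proof (rule inj_onI)
    fix x x' assume x: "x \<in> X" "x' \<in> X" "\<Psi> x = \<Psi> x'"
    obtain f where f: "f \<in> F" using F by blast
    have "x t = x' t" for t
    proof -
      have "agree_on ((\<lambda>g. g + (t - f)) ` F) x x'" using eq x by metis
      then show ?thesis using f by (force simp: agree_on_def)
    qed
    then show "x = x'" by blast
  qed
  have equivariant: "\<Psi> (shift u x) = shift u (\<Psi> x)" for u x
    by (simp add: \<Psi>_def window_code_def shift_def add_ac)
  have cont: "continuous_map (full_shift A) (full_shift B) \<Psi>"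
  proof (rule continuous_map_full_shift_if_local[where W = "\<lambda>w. (\<lambda>f. f + w) ` F"])
    show "range (\<Psi> x) \<subseteq> B" if "x \<in> topspace (full_shift A)" for x
      using that pattern by (auto simp: \<Psi>_def window_code_def B_def topspace_full_shift)
    show "finite ((\<lambda>f. f + w) ` F)" for w using F by simp
    show "\<Psi> x w = \<Psi> x' w" if "agree_on ((\<lambda>f. f + w) ` F) x x'" for x x' w
      using that by (simp add: \<Psi>_def window_code_def flip: agree)
  qed
  have "compactin (full_shift A) X"
    using compact_space_subshift[OF X] XA by (simp add: compactin_subspace topspace_full_shift)
  then have "compactin (full_shift B) Y"
    unfolding Y_def using cont by (rule image_compactin)
  then have closed: "closedin (full_shift B) Y"
    using Hausdorff_full_shift by (rule compactin_imp_closedin[rotated])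
  have shiftY: "shift u ` Y = Y" for u
  proof -
    have "shift u ` Y = \<Psi> ` shift u ` X" by (simp add: Y_def image_image equivariant)
    then show ?thesis using shiftX by (simp add: Y_def)
  qed
  have subY: "subshift B Y"
    using closed shiftY finP by (simp add: subshift_def B_def)
  have YB: "Y \<subseteq> topspace (full_shift B)" using closed by (rule closedin_subset)
  have "homeomorphic_map (subtopology (full_shift A) X) (subtopology (full_shift B) Y) \<Psi>"
  proof (rule continuous_imp_homeomorphic_map)
    show "continuous_map (subtopology (full_shift A) X) (subtopology (full_shift B) Y) \<Psi>"
      using cont by (auto simp: continuous_map_in_subtopology Y_def intro: continuous_map_from_subtopology)
    show "compact_space (subtopology (full_shift A) X)" by (rule compact_space_subshift[OF X])
    show "Hausdorff_space (subtopology (full_shift B) Y)"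
      using Hausdorff_full_shift by (rule Hausdorff_space_subtopology)
    have "topspace (subtopology (full_shift A) X) = X" "topspace (subtopology (full_shift B) Y) = Y"
      using XA YB by (simp_all add: topspace_full_shift Int_absorb1)
    then show "\<Psi> ` topspace (subtopology (full_shift A) X) = topspace (subtopology (full_shift B) Y)"
      "inj_on \<Psi> (topspace (subtopology (full_shift A) X))"
      using inj by (simp_all add: Y_def)
  qed
  then have "recoding A X B Y"
    unfolding recoding_def using X subY F(1) equivariant eq by blast
  then show thesis using that Y_def inj eq by blast
qed

section \<open>Polygonality of the recoding\<close>

theorem proposition3p12:
  fixes A :: "'a set" and X :: "'a config set" and P P0 :: "(real \<times> real) set" and n :: nat
  assumes "coding_polygon A X P"
    and "convex_integer_polygon P0"
    and "n > 1"
    and "P = dilate (real n) P0"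
  shows "\<exists>(B :: nat set) (Y :: nat config set).
           recoding A X B Y \<and> coding_polygon B Y P0 \<and>
           (\<forall>m::nat. m > 0 \<longrightarrow>
              dilate (real m) P0 = dilate (real m / real n) P \<and>
              coding_polygon B Y (dilate (real m) P0))"
proof -
  note P0 = assms(2)
  have poly: "polytope P0" using P0 by (simp add: convex_integer_polygon_def)
  have X: "coding_polygon A X (dilate (real n) P0)" using assms(1,4) by simp
  let ?E = "{w. w extreme_point_of P0}"
  \<comment> \<open>The least dilation factor to which the corner-filling argument applies.\<close>
  define k where "k = card ?E + n"
  define F where "F = lattice_point -` dilate (real k - 1) P0"
  have k: "0 < k" using assms(3) by (simp add: k_def)
  have "finite F"
    unfolding F_def dilate_def using poly
    by (intro finite_lattice_points bounded_scaling polytope_imp_bounded)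
  moreover have "F \<noteq> {}"
  proof -
    obtain v where v: "v extreme_point_of P0" using convex_hull_extreme_points(2)[OF P0] by blast
    obtain z where "v = lattice_point z" using v P0 unfolding convex_integer_polygon_def by blast
    then have "lattice_point (int (k - 1) * fst z, int (k - 1) * snd z) = (real k - 1) *\<^sub>R v"
      using scaleR_lattice_point[of "k - 1" z] k by (simp add: of_nat_diff)
    moreover have "v \<in> P0" using v by (simp add: extreme_point_of_def)
    ultimately show ?thesis by (auto simp: F_def dilate_def)
  qed
  moreover have "subshift A X" using X by (simp add: coding_polygon_def)
  ultimately obtain B :: "nat set" and Y \<Psi> where Y: "recoding A X B Y" "Y = \<Psi> ` X" "inj_on \<Psi> X"
    and eq: "\<And>w x x'. x \<in> X \<Longrightarrow> x' \<in> X \<Longrightarrow> \<Psi> x w = \<Psi> x' w \<longleftrightarrow> agree_on ((\<lambda>f. f + w) ` F) x x'"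
    using recoding_by_window[of A X F] by metis
  have "codes Y (P0 - {v}) {v}" if v: "v extreme_point_of P0" for v
    unfolding codes_def
  proof (intro ballI impI)
    fix y y' assume "y \<in> Y" "y' \<in> Y" and ag: "agree_on (lattice_point -` (P0 - {v})) y y'"
    then obtain x x' where x: "x \<in> X" "x' \<in> X" "y = \<Psi> x" "y' = \<Psi> x'" by (auto simp: Y(2))
    have big: "agree_on (lattice_point -` dilate (real k) P0) x x'"
    proof (rule agree_on_dilate_if_other_vertices[OF X P0 _ v _ x(1,2)])
      show "0 < n" using assms(3) by simp
      show "real (card ?E) + real n \<le> real k" by (simp add: k_def)
      fix w t assume w: "w extreme_point_of P0" "w \<noteq> v" "lattice_point t - w \<in> dilate (real k - 1) P0"
      obtain z where z: "w = lattice_point z" using w(1) P0 unfolding convex_integer_polygon_def by blast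
      have "w \<in> P0" using w by (simp add: extreme_point_of_def)
      then have "y z = y' z" using ag w(2) by (simp add: agree_on_def z)
      then have "agree_on ((\<lambda>f. f + z) ` F) x x'" using eq x by blast
      moreover have "t - z \<in> F" using w(3) by (simp add: F_def z lattice_point_diff)
      ultimately show "x t = x' t" by (force simp: agree_on_def)
    qed
    show "agree_on (lattice_point -` {v}) y y'"
      unfolding agree_on_def
    proof
      fix z assume "z \<in> lattice_point -` {v}"
      then have z: "lattice_point z = v" by simp
      have "lattice_point (f + z) \<in> dilate (real k) P0" if "f \<in> F" for f
      proof -
        have "v \<in> dilate 1 P0" using v by (simp add: extreme_point_of_def dilate_def)
        then have "lattice_point f + v \<in> dilate (real k - 1 + 1) P0"
          using that poly k by (intro dilate_add_mem polytope_imp_convex) (auto simp: F_def)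
        then show ?thesis by (simp add: lattice_point_add z)
      qed
      then have "agree_on ((\<lambda>f. f + z) ` F) x x'" using big by (auto simp: agree_on_def)
      then show "y z = y' z" using eq x by blast
    qed
  qed
  moreover have "infinite Y"
    using X Y(2,3) by (simp add: coding_polygon_def finite_image_iff)
  moreover have "subshift B Y" using Y(1) by (simp add: recoding_def)
  ultimately have P0Y: "coding_polygon B Y P0" using P0 by (simp add: coding_polygon_def)
  have "dilate (real m) P0 = dilate (real m / real n) P" for m
    using assms(3,4) by (simp add: dilate_dilate)
  then show ?thesis using Y(1) P0Y coding_polygon_dilate by blast
qed

end
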